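(* For every positive integer $r$, the number $\frac{2n_r}{r}$ is an integer. Moreover, $\frac{n_r}{r}$ is an integer if and only if either $r$ is odd, or else $r=2^k r_1$ with $k>0$ and $r_1$ odd, and the set $\{w\in\mathcal W : w\mid r_1 \text{ and } \tfrac{r_1}{w} \text{ is squarefree}\}$ has even cardinality.
   Context: For a positive integer $r$ define the rational number $$n_r = \frac{1}{r^{2}}\sum_{d\mid r}\mu\left(\frac rd\right)\binom{3d-1}{d-1},$$ where the sum is over positive divisors $d$ of $r$ and $\mu$ is the Möbius function. A positive integer $m=\sum_{j=0}^J\epsilon_j2^j$ with $\epsilon_j\in\{0,1\}$ is called (binarily) well-spaced if $\epsilon_j\epsilon_{j+1}=0$ for all $j=0,1,\dots,J-1$, i.e. its binary expansion has no two consecutive 1's. $\mathcal W$ denotes the set of all odd positive integers that are binarily well-spaced, so $\mathcal W=\{1,5,9,17,21,33,37,41,\dots\}$. The integer $1$ is squarefree. *)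

theory Defs
  imports Complex_Main "HOL-Computational_Algebra.Squarefree"
begin

definition moebius_mu :: "nat \<Rightarrow> int" where
  "moebius_mu n = (if squarefree n then (-1) ^ card (prime_factors n) else 0)"

(* In the range of the sum d >= 1 and d dvd r, so neither natural subtraction nor div truncates. *)
definition n_r :: "nat \<Rightarrow> rat" where
  "n_r r = 1 / of_nat r ^ 2 *
     (\<Sum>d | d dvd r. of_int (moebius_mu (r div d)) * of_nat ((3 * d - 1) choose (d - 1)))"

(* bit m j is the j-th binary digit of m, counted from the least significant one (j = 0);
   digits beyond the leading one are False, so no upper bound on j is needed. *)
definition well_spaced :: "nat \<Rightarrow> bool" where
  "well_spaced m \<longleftrightarrow> m > 0 \<and> (\<forall>j. \<not> (bit m j \<and> bit m (Suc j)))"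

definition odd_well_spaced :: "nat set" where
  "odd_well_spaced = {w. odd w \<and> well_spaced w}"

end

theory Submission
  imports Defs "HOL-Number_Theory.Residues"
begin

text \<open>Write \<open>a(d)\<close> for \<open>(3d - 1) choose (d - 1)\<close>, a third of \<open>3d choose d\<close>, and \<open>S(r)\<close> for its Moebius
  sum over the divisors of \<open>r\<close>. The number in question is \<open>S(r) / r ^ 3\<close>, so everything is a matter
  of divisibility of \<open>S(r)\<close> by prime powers. If \<open>r = p ^ k s\<close> with \<open>p\<close> not dividing \<open>s\<close>, then \<open>S(r)\<close> is a
  signed sum of the differences \<open>a(p ^ k d) - a(p ^ (k - 1) d)\<close> over the divisors \<open>d\<close> of \<open>s\<close> with
  squarefree cofactor (\<open>moebius_sum_prime_power\<close>).

  For odd \<open>p\<close> each difference is divisible by \<open>p ^ (3k)\<close>, a congruence of Jacobsthal type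
  (\<open>third_binomial_cong_odd_prime\<close>). For \<open>p = 2\<close> and odd \<open>d\<close> it is congruent to
  \<open>2 ^ (3k - 1) a(2 ^ (k - 1) d)\<close> modulo \<open>2 ^ (3k)\<close> (\<open>third_binomial_cong_2\<close>). Hence \<open>2 S(r)\<close> is divisible by
  \<open>r ^ 3\<close>, and for even \<open>r\<close> the divisibility of \<open>S(r)\<close> itself depends on how many of the
  \<open>a(2 ^ (k - 1) d)\<close> are odd. By Lucas' theorem modulo two, \<open>a(2 ^ (k - 1) d)\<close> is odd exactly if \<open>d\<close> is
  well-spaced (\<open>odd_binomial_3n_n_iff\<close>), and this yields the stated set.

  Both congruences come from one computation. With \<open>N = pm\<close> and \<open>P(x)\<close> the product of
  \<open>x + i\<close> over the \<open>i\<close> between \<open>0\<close> and \<open>N\<close> that are not divisible by \<open>p\<close>, the ratio of \<open>a(N)\<close> to \<open>a(m)\<close> is that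
  of \<open>P(2N)\<close> to \<open>P(0)\<close>. Pairing \<open>i\<close> with \<open>N - i\<close> gives \<open>(2N + i)(3N - i) = 6N\<^sup>2 + i(N - i)\<close>, so
  modulo \<open>p ^ (3k)\<close> only the term linear in \<open>6N\<^sup>2\<close> survives; its coefficient is a sum of
  inverse squares modulo \<open>p ^ k\<close>. Three times this sum vanishes for odd \<open>p\<close>. For \<open>p = 2\<close> and \<open>k > 1\<close> the
  pairs run through half of the range only and the sum is exactly divisible by \<open>2 ^ (k - 2)\<close>, while
  for \<open>k = 1\<close> the correction comes from the unpaired factor \<open>i = N / 2\<close>.\<close>

section \<open>The factor between the binomials at \<open>m\<close> and \<open>pm\<close>\<close>

text \<open>For positive \<open>n\<close> this is a third of \<open>3n choose n\<close>. The division by \<open>3\<close> matters at the prime \<open>3\<close>,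
  where a power of \<open>3\<close> would be lost by arguing with \<open>3n choose n\<close> itself.\<close>

definition third_binomial :: "nat \<Rightarrow> int" where
  "third_binomial n = int ((3 * n - 1) choose (n - 1))"

definition punctured_prod :: "int \<Rightarrow> int \<Rightarrow> int \<Rightarrow> int" where
  "punctured_prod p n x = (\<Prod>i | 0 < i \<and> i < n \<and> \<not> p dvd i. x + i)"

lemma binomial_3n_n_eq:
  assumes "n > 0"
  shows "int ((3 * n) choose n) = 3 * third_binomial n"
proof -
  have "Suc (n - 1) * (Suc (3 * n - 1) choose Suc (n - 1)) = Suc (3 * n - 1) * ((3 * n - 1) choose (n - 1))"
    by (metis Suc_times_binomial_eq mult.commute)
  then have "n * ((3 * n) choose n) = n * (3 * ((3 * n - 1) choose (n - 1)))"
    using assms by simp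
  then have "(3 * n) choose n = 3 * ((3 * n - 1) choose (n - 1))"
    using assms by simp
  then show ?thesis
    by (simp add: third_binomial_def)
qed

lemma fact_times_prod_shift:
  "(fact m :: int) * (\<Prod>i\<in>{0<..int n}. int m + i) = fact (m + n)"
proof (induction n)
  case (Suc n)
  have "{0<..int (Suc n)} = insert (int (Suc n)) {0<..int n}"
    by auto
  then have "fact m * (\<Prod>i\<in>{0<..int (Suc n)}. int m + i)
      = (int m + int (Suc n)) * (fact m * (\<Prod>i\<in>{0<..int n}. int m + i))"
    by simp
  also have "\<dots> = fact (m + Suc n)"
    unfolding Suc.IH by simp
  finally show ?case .
qed simp

lemma prod_shift_eq_binomial:
  "(\<Prod>i\<in>{0<..int n}. 2 * int n + i) = int ((3 * n) choose n) * (\<Prod>i\<in>{0<..int n}. i)"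
proof -
  have "fact n * fact (3 * n - n) * ((3 * n) choose n) = (fact (3 * n) :: nat)"
    by (rule binomial_fact_lemma) simp
  then have "int (fact n * fact (3 * n - n) * ((3 * n) choose n)) = int (fact (3 * n))"
    by (rule arg_cong)
  then have "fact (2 * n) * (int ((3 * n) choose n) * fact n) = fact (2 * n + n)"
    by (simp add: mult_ac)
  moreover have "fact n = (\<Prod>i\<in>{0<..int n}. i)"
    using fact_times_prod_shift [of 0 n] by simp
  ultimately show ?thesis
    using fact_times_prod_shift [of "2 * n" n] by (metis fact_nonzero mult_cancel_left of_nat_mult of_nat_numeral)
qed

lemma prod_split_multiples:
  fixes p m :: int and g :: "int \<Rightarrow> 'a :: comm_monoid_mult"
  assumes "p > 1"
  shows "(\<Prod>i\<in>{0<..p * m}. g i)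
    = (\<Prod>j\<in>{0<..m}. g (p * j)) * (\<Prod>i | 0 < i \<and> i < p * m \<and> \<not> p dvd i. g i)"
proof -
  let ?U = "{i. 0 < i \<and> i < p * m \<and> \<not> p dvd i}"
  have fin: "finite ?U"
    by (rule finite_subset [of _ "{0<..p * m}"]) auto
  have "x \<in> (*) p ` {0<..m}" if "0 < x" "x \<le> p * m" "p dvd x" for x
    using that assms by (auto simp: zero_less_mult_iff)
  moreover have "i \<noteq> p * m" if "\<not> p dvd i" for i
    using that by auto
  ultimately have "{0<..p * m} = (*) p ` {0<..m} \<union> ?U"
    using assms by (fastforce simp: zero_less_mult_iff)
  moreover have "(*) p ` {0<..m} \<inter> ?U = {}"
    by auto
  ultimately have "(\<Prod>i\<in>{0<..p * m}. g i) = (\<Prod>i\<in>(*) p ` {0<..m}. g i) * (\<Prod>i\<in>?U. g i)"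
    using fin by (simp add: prod.union_disjoint)
  moreover have "(\<Prod>i\<in>(*) p ` {0<..m}. g i) = (\<Prod>j\<in>{0<..m}. g (p * j))"
    using assms by (subst prod.reindex) (auto simp: inj_on_def)
  ultimately show ?thesis
    by simp
qed

text \<open>In \<open>(3n choose n) \<cdot> n! = (2n + 1) \<cdots> (2n + n)\<close> with \<open>n = pm\<close>, the factors divisible by \<open>p\<close> make up
  the same product for \<open>m\<close>, up to a power of \<open>p\<close> that also occurs in \<open>n!\<close>. Only the factors prime
  to \<open>p\<close> are left over.\<close>

lemma third_binomial_mult:
  fixes p m :: nat
  assumes "p > 1" "m > 0"
  defines "N \<equiv> int (p * m)"
  shows "third_binomial (p * m) * punctured_prod (int p) N 0
    = third_binomial m * punctured_prod (int p) N (2 * N)"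
proof -
  let ?B = "\<lambda>n. int ((3 * n) choose n)"
  let ?F = "\<Prod>j\<in>{0<..int m}. int p * j"
  have N: "N = int p * int m"
    by (simp add: N_def)
  have nz: "?F \<noteq> 0"
    using assms by auto
  have "(\<Prod>i\<in>{0<..N}. 2 * N + i)
      = (\<Prod>j\<in>{0<..int m}. int p * (2 * int m + j)) * punctured_prod (int p) N (2 * N)"
    using assms(1) unfolding N punctured_prod_def
    by (subst prod_split_multiples) (simp_all add: algebra_simps)
  also have "(\<Prod>j\<in>{0<..int m}. int p * (2 * int m + j)) = ?B m * ?F"
    using prod_shift_eq_binomial [of m] by (simp add: prod.distrib)
  finally have "?B (p * m) * (\<Prod>i\<in>{0<..N}. i) = ?B m * ?F * punctured_prod (int p) N (2 * N)"
    unfolding N_def prod_shift_eq_binomial .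
  moreover have "(\<Prod>i\<in>{0<..N}. i) = ?F * punctured_prod (int p) N 0"
    using assms(1) unfolding N punctured_prod_def by (subst prod_split_multiples) simp_all
  ultimately have "?B (p * m) * punctured_prod (int p) N 0 = ?B m * punctured_prod (int p) N (2 * N)"
    using nz by simp
  then show ?thesis
    using assms by (simp add: binomial_3n_n_eq)
qed

text \<open>The product of the \<open>i\<close> prime to \<open>p\<close> is invertible modulo every power of \<open>p\<close>, so a congruence between
  the two punctured products is one between the two binomials.\<close>

lemma punctured_prod_cong_imp_third_binomial_cong:
  fixes p m :: nat
  assumes "prime p" "m > 0"
    and P: "[punctured_prod (int p) (int (p * m)) (2 * int (p * m))
      = punctured_prod (int p) (int (p * m)) 0 * u] (mod int p ^ k)"
  shows "[third_binomial (p * m) = third_binomial m * u] (mod int p ^ k)"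
proof -
  let ?P = "punctured_prod (int p) (int (p * m))"
  have "coprime i (int p)" if "\<not> int p dvd i" for i
    using that assms(1) prime_imp_coprime [of "int p" i] by (simp add: coprime_commute)
  then have "coprime (?P 0) (int p ^ k)"
    unfolding punctured_prod_def by (auto intro!: prod_coprime_left)
  moreover have "third_binomial (p * m) * ?P 0 = third_binomial m * ?P (2 * int (p * m))"
    using assms(1,2) by (intro third_binomial_mult prime_gt_1_nat)
  then have "[third_binomial (p * m) * ?P 0 = third_binomial m * (?P 0 * u)] (mod int p ^ k)"
    using P by (simp add: cong_scalar_left)
  then have "[third_binomial (p * m) * ?P 0 = third_binomial m * u * ?P 0] (mod int p ^ k)"
    by (simp add: mult_ac)
  ultimately show ?thesis
    by (simp add: cong_mult_rcancel)
qed

section \<open>Products over reflected pairs\<close>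

lemma punctured_prod_reflect:
  fixes p m N x :: int
  assumes "N = p * m"
  shows "punctured_prod p N x = (\<Prod>i | 0 < i \<and> i < N \<and> \<not> p dvd i. x + (N - i))"
  unfolding punctured_prod_def
proof (rule prod.reindex_bij_witness [of _ "\<lambda>i. N - i" "\<lambda>i. N - i"])
  fix i assume "i \<in> {i. 0 < i \<and> i < N \<and> \<not> p dvd i}"
  then show "N - i \<in> {i. 0 < i \<and> i < N \<and> \<not> p dvd i}"
    using assms by (auto simp: dvd_diff_right_iff)
qed (use assms in \<open>auto simp: dvd_diff_right_iff\<close>)

text \<open>Since \<open>(x + i)(x + N - i) = x(x + N) + i(N - i)\<close>, pairing \<open>i\<close> with \<open>N - i\<close> turns a shift by a multiple
  of \<open>N\<close> into a shift by a multiple of \<open>N\<^sup>2\<close>. The expansion of the product in that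
  shift then stops after the linear term, because the square of the shift is divisible by \<open>q ^ 4\<close>.
  The coefficient is a sum of inverses of \<open>i(N - i)\<close>, needed only modulo \<open>q\<close>, so that
  they become the inverses of \<open>- i\<^sup>2\<close>; these inverses are written as powers with a
  common exponent \<open>t\<close>, which makes them multiplicative and compatible with congruences.\<close>

lemma prod_shifted_pairs_cong:
  fixes x N q :: int
  assumes "finite H" "q ^ 2 dvd x" "q dvd N"
    and inv: "\<And>i. i \<in> H \<Longrightarrow> [(i ^ 2) ^ Suc t = 1] (mod q)"
  shows "[(\<Prod>i\<in>H. x + i * (N - i)) = (\<Prod>i\<in>H. i * (N - i)) * (1 - x * (\<Sum>i\<in>H. (i ^ 2) ^ t))] (mod q ^ 3)"
  using assms(1) inv
proof (induction H)
  case (insert i H)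
  let ?c = "i * (N - i)" and ?e = "(i ^ 2) ^ t" and ?S = "\<Sum>i\<in>H. (i ^ 2) ^ t"
  have q3: "q ^ 3 = q ^ 2 * q"
    by (simp add: power3_eq_cube power2_eq_square)
  have xN: "q ^ 3 dvd x * N"
    unfolding q3 using assms by (intro mult_dvd_mono)
  have "q dvd 1 - i ^ 2 * ?e"
    using insert.prems [of i] by (simp add: cong_iff_dvd_diff dvd_diff_commute)
  then have "q ^ 3 dvd x * (1 - i ^ 2 * ?e)"
    unfolding q3 using assms by (intro mult_dvd_mono)
  then have "q ^ 3 dvd x * (1 - i ^ 2 * ?e) + x * N * (i * ?e)"
    using xN by (meson dvd_add dvd_mult2)
  also have "\<dots> = (x + ?c) - ?c * (1 - x * ?e)"
    by (simp add: algebra_simps power2_eq_square)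
  finally have 1: "[x + ?c = ?c * (1 - x * ?e)] (mod q ^ 3)"
    by (simp add: cong_iff_dvd_diff)
  have "q ^ 3 dvd q ^ 2 * q ^ 2"
    by (simp add: q3 power2_eq_square)
  also have "\<dots> dvd x * x"
    using assms by (intro mult_dvd_mono)
  finally have "q ^ 3 dvd x * x * (?e * ?S)"
    by (rule dvd_mult2)
  also have "x * x * (?e * ?S) = (1 - x * ?e) * (1 - x * ?S) - (1 - x * (?e + ?S))"
    by (simp add: algebra_simps)
  finally have 2: "[(1 - x * ?e) * (1 - x * ?S) = 1 - x * (?e + ?S)] (mod q ^ 3)"
    by (simp add: cong_iff_dvd_diff)
  have "[(x + ?c) * (\<Prod>i\<in>H. x + i * (N - i))
      = ?c * (1 - x * ?e) * ((\<Prod>i\<in>H. i * (N - i)) * (1 - x * ?S))] (mod q ^ 3)"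
    using insert.IH insert.prems by (intro cong_mult 1) simp_all
  also have "?c * (1 - x * ?e) * ((\<Prod>i\<in>H. i * (N - i)) * (1 - x * ?S))
      = ?c * (\<Prod>i\<in>H. i * (N - i)) * ((1 - x * ?e) * (1 - x * ?S))"
    by (simp only: mult_ac)
  also have "[\<dots> = ?c * (\<Prod>i\<in>H. i * (N - i)) * (1 - x * (?e + ?S))] (mod q ^ 3)"
    using 2 by (intro cong_mult cong_refl)
  finally show ?case
    using insert.hyps by simp
qed simp

lemma ex_inverse_exponent:
  fixes q :: nat
  assumes "q > 0"
  obtains t where "\<And>y :: int. coprime y (int q) \<Longrightarrow> [y ^ Suc t = 1] (mod int q)"
proof
  fix y :: int
  assume y: "coprime y (int q)"
  have q: "Suc (totient q - 1) = totient q"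
    using assms by simp
  define z where "z = nat (y mod int q)"
  have z: "[int z = y] (mod int q)"
    using assms by (simp add: z_def)
  have "coprime z q"
    using y z by (metis coprime_cong_cong_left coprime_int_iff)
  then have "[int z ^ totient q = 1] (mod int q)"
    using euler_theorem [of z q] by (metis cong_int_iff of_nat_1 of_nat_power)
  then show "[y ^ Suc (totient q - 1) = 1] (mod int q)"
    unfolding q using z by (meson cong_pow cong_sym cong_trans)
qed

section \<open>Odd primes\<close>

lemma odd_prime_not_dvd_2:
  assumes "prime (p :: nat)" "odd p"
  shows "\<not> p dvd 2"
  using assms primes_dvd_imp_eq two_is_prime_nat by blast

lemma sum_periodic_cong:
  fixes h :: "int \<Rightarrow> int" and q :: int
  assumes "q > 0" and per: "\<And>i. [h (i + q) = h i] (mod q)"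
  shows "[(\<Sum>i\<in>{0..<q * int c}. h i) = int c * (\<Sum>i\<in>{0..<q}. h i)] (mod q)"
proof (induction c)
  case (Suc c)
  have shift: "[h (i + q * int j) = h i] (mod q)" for i j
  proof (induction j)
    case (Suc j)
    have "[h (i + q * int j + q) = h i] (mod q)"
      using per Suc.IH by (rule cong_trans)
    then show ?case
      by (simp add: algebra_simps)
  qed simp
  have nonneg: "0 \<le> q * int c"
    using assms(1) by simp
  have "{0..<q * int (Suc c)} = {0..<q * int c} \<union> (\<lambda>i. i + q * int c) ` {0..<q}"
    using assms(1) by (auto simp: algebra_simps intro: order_trans [OF nonneg])
  moreover have "{0..<q * int c} \<inter> (\<lambda>i. i + q * int c) ` {0..<q} = {}"
    by auto
  moreover have "sum h ((\<lambda>i. i + q * int c) ` {0..<q}) = (\<Sum>i\<in>{0..<q}. h (i + q * int c))"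
    by (subst sum.reindex) (auto simp: inj_on_def)
  ultimately have "(\<Sum>i\<in>{0..<q * int (Suc c)}. h i)
      = (\<Sum>i\<in>{0..<q * int c}. h i) + (\<Sum>i\<in>{0..<q}. h (i + q * int c))"
    by (simp only: sum.union_disjoint finite_imageI finite_atLeastLessThan_int)
  also have "[\<dots> = int c * (\<Sum>i\<in>{0..<q}. h i) + (\<Sum>i\<in>{0..<q}. h i)] (mod q)"
    by (intro cong_add Suc.IH cong_sum shift)
  finally show ?case
    by (simp add: algebra_simps)
qed simp

text \<open>Doubling permutes the residues modulo \<open>p ^ k\<close> and preserves those prime to \<open>p\<close>, so the sum of the
  inverse squares equals its own quarter, which means that three times the sum vanishes. For \<open>p = 3\<close>
  the factor \<open>3\<close> cannot be cancelled; it is kept for all odd \<open>p\<close>, because the sum is going to be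
  multiplied by \<open>6N\<^sup>2\<close>.\<close>

lemma sum_inverse_squares_cong_0:
  fixes p k c t :: nat
  assumes "prime p" "odd p" "k > 0"
    and t: "\<And>y. coprime y (int p ^ k) \<Longrightarrow> [y ^ Suc t = 1] (mod int p ^ k)"
  shows "int p ^ k dvd 3 * (\<Sum>i | 0 < i \<and> i < int p ^ k * int c \<and> \<not> int p dvd i. (i ^ 2) ^ t)"
proof -
  define q where "q = int p ^ k"
  define h where "h i = (if int p dvd i then 0 else (i ^ 2) ^ t)" for i :: int
  have q: "q > 0"
    using assms(1) by (simp add: q_def prime_gt_0_nat)
  have pq: "int p dvd q"
    using assms(3) by (simp add: q_def)
  have cop: "coprime 2 q"
    using assms(2) by (simp add: q_def)
  have h_cong: "[h i = h j] (mod q)" if "[i = j] (mod q)" for i j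
  proof -
    have "int p dvd i \<longleftrightarrow> int p dvd j"
      using that pq cong_dvd_iff cong_dvd_modulus by blast
    then show ?thesis
      using that by (auto simp: h_def intro!: cong_pow)
  qed
  have per: "[(\<Sum>i\<in>{0..<q * int c}. h i) = int c * (\<Sum>i\<in>{0..<q}. h i)] (mod q)"
    using q by (intro sum_periodic_cong h_cong) (auto simp: cong_def)
  have inj: "inj_on (\<lambda>i. 2 * i mod q) {0..<q}"
  proof (rule inj_onI)
    fix i j assume ij: "i \<in> {0..<q}" "j \<in> {0..<q}" "2 * i mod q = 2 * j mod q"
    then have "[i = j] (mod q)"
      using cop by (simp add: cong_def [symmetric] cong_mult_lcancel)
    then show "i = j"
      using ij by (simp add: cong_def)
  qed
  have "(\<lambda>i. 2 * i mod q) ` {0..<q} \<subseteq> {0..<q}"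
    using q by auto
  then have img: "(\<lambda>i. 2 * i mod q) ` {0..<q} = {0..<q}"
    using inj by (simp add: endo_inj_surj)
  have "\<not> int p dvd 2"
    using odd_prime_not_dvd_2 [OF assms(1,2)] int_dvd_int_iff [of p 2] by simp
  then have dbl: "h (2 * i) = 4 ^ t * h i" for i
    using assms(1) by (simp add: h_def power_mult_distrib prime_dvd_mult_iff)
  have "(\<Sum>i\<in>{0..<q}. h i) = (\<Sum>i\<in>{0..<q}. h (2 * i mod q))"
    using sum.reindex [OF inj, of h] unfolding img by simp
  also have "[\<dots> = (\<Sum>i\<in>{0..<q}. h (2 * i))] (mod q)"
    by (intro cong_sum h_cong) simp
  also have "(\<Sum>i\<in>{0..<q}. h (2 * i)) = 4 ^ t * (\<Sum>i\<in>{0..<q}. h i)"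
    by (simp add: dbl sum_distrib_left)
  finally have "[4 * (\<Sum>i\<in>{0..<q}. h i) = 4 * (4 ^ t * (\<Sum>i\<in>{0..<q}. h i))] (mod q)"
    by (rule cong_scalar_left)
  also have "4 * (4 ^ t * (\<Sum>i\<in>{0..<q}. h i)) = 4 ^ Suc t * (\<Sum>i\<in>{0..<q}. h i)"
    by simp
  also have "[\<dots> = 1 * (\<Sum>i\<in>{0..<q}. h i)] (mod q)"
  proof (rule cong_scalar_right)
    have "coprime (2 ^ 2) q"
      using cop by (rule coprime_power_left_iff [THEN iffD2, OF disjI1])
    then show "[4 ^ Suc t = 1] (mod q)"
      unfolding q_def by (intro t) simp
  qed
  finally have "q dvd 3 * (\<Sum>i\<in>{0..<q}. h i)"
    by (simp add: cong_iff_dvd_diff)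
  then have "q dvd int c * (3 * (\<Sum>i\<in>{0..<q}. h i))"
    by (rule dvd_mult)
  moreover have "[3 * (\<Sum>i\<in>{0..<q * int c}. h i) = 3 * (int c * (\<Sum>i\<in>{0..<q}. h i))] (mod q)"
    using per by (rule cong_scalar_left)
  ultimately have "q dvd 3 * (\<Sum>i\<in>{0..<q * int c}. h i)"
    by (simp add: cong_dvd_iff mult_ac)
  also have "(\<Sum>i\<in>{0..<q * int c}. h i)
      = (\<Sum>i | 0 < i \<and> i < q * int c \<and> \<not> int p dvd i. (i ^ 2) ^ t)"
    by (rule sum.mono_neutral_cong_right) (auto simp: h_def order_le_less)
  finally show ?thesis
    unfolding q_def .
qed

text \<open>By reflection the square of the punctured product is a product over pairs, and its linear term
  vanishes modulo \<open>p ^ (3k)\<close>. So the squares of the two punctured products agree, and their roots agree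
  too: their sum is congruent modulo \<open>p\<close> to twice a unit, hence is itself a unit.\<close>

lemma third_binomial_cong_odd_prime:
  fixes p k d :: nat
  assumes "prime p" "odd p" "k > 0" "d > 0"
  shows "[third_binomial (p ^ k * d) = third_binomial (p ^ (k - 1) * d)] (mod int p ^ (3 * k))"
proof -
  define m where "m = p ^ (k - 1) * d"
  define N where "N = int (p * m)"
  define q where "q = int p ^ k"
  define U where "U = {i. 0 < i \<and> i < N \<and> \<not> int p dvd i}"
  define P where "P = punctured_prod (int p) N"
  have pm: "p * m = p ^ k * d"
    using assms(3) by (simp add: m_def power_eq_if)
  have q3: "q ^ 3 = int p ^ (3 * k)"
    by (simp add: q_def power_mult [symmetric] mult.commute)
  have N: "N = q * int d" "N = int p * int m"
    unfolding N_def by (simp only: pm, simp add: q_def) simp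
  have "0 < p ^ k"
    using assms(1) by (simp add: prime_gt_0_nat)
  then obtain t where t: "\<And>y. coprime y (int p ^ k) \<Longrightarrow> [y ^ Suc t = 1] (mod int p ^ k)"
    using ex_inverse_exponent [of "p ^ k"] by auto
  have cop: "coprime i q" if "i \<in> U" for i
    using that assms(1) prime_imp_coprime [of "int p" i] unfolding U_def q_def
    by (simp add: coprime_commute)
  have "finite U"
    unfolding U_def by (rule finite_subset [of _ "{0<..<N}"]) auto
  have sq: "P x * P x = (\<Prod>i\<in>U. x * (x + N) + i * (N - i))" for x
  proof -
    have "P x * P x = (\<Prod>i\<in>U. x + i) * (\<Prod>i\<in>U. x + (N - i))"
      using punctured_prod_reflect [OF N(2), of x]
      unfolding P_def U_def by (simp add: punctured_prod_def)
    also have "\<dots> = (\<Prod>i\<in>U. x * (x + N) + i * (N - i))"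
      by (simp add: prod.distrib [symmetric] algebra_simps)
    finally show ?thesis .
  qed
  let ?S = "\<Sum>i\<in>U. (i ^ 2) ^ t"
  have x: "2 * N * (2 * N + N) = N * N * 6"
    by simp
  have NN: "q ^ 2 dvd N * N"
    unfolding N(1) power2_eq_square by (intro mult_dvd_mono) auto
  have "[P (2 * N) * P (2 * N) = (\<Prod>i\<in>U. i * (N - i)) * (1 - N * N * 6 * ?S)] (mod q ^ 3)"
    unfolding sq x
  proof (rule prod_shifted_pairs_cong)
    show "[(i ^ 2) ^ Suc t = 1] (mod q)" if "i \<in> U" for i
      using cop [OF that] unfolding q_def by (intro t) auto
  qed (use NN N \<open>finite U\<close> in auto)
  also have "(\<Prod>i\<in>U. i * (N - i)) = P 0 * P 0"
    unfolding sq by simp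
  also have "[P 0 * P 0 * (1 - N * N * 6 * ?S) = P 0 * P 0 * 1] (mod q ^ 3)"
  proof (rule cong_scalar_left)
    have "q dvd 3 * ?S"
      using sum_inverse_squares_cong_0 [OF assms(1-3) t, of d]
      unfolding U_def N(1) by (simp add: q_def)
    then have "q ^ 2 * q dvd N * N * (2 * (3 * ?S))"
      by (intro mult_dvd_mono NN) (rule dvd_mult)
    then show "[1 - N * N * 6 * ?S = 1] (mod q ^ 3)"
      by (simp add: cong_iff_dvd_diff power3_eq_cube power2_eq_square mult_ac)
  qed
  finally have "q ^ 3 dvd P (2 * N) * P (2 * N) - P 0 * P 0"
    by (simp add: cong_iff_dvd_diff)
  also have "\<dots> = (P (2 * N) - P 0) * (P (2 * N) + P 0)"
    by (simp add: algebra_simps)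
  finally have "q ^ 3 dvd (P (2 * N) - P 0) * (P (2 * N) + P 0)" .
  moreover have "coprime (q ^ 3) (P (2 * N) + P 0)"
  proof -
    have "[P (2 * N) = P 0] (mod int p)"
      unfolding P_def punctured_prod_def by (intro cong_prod) (auto simp: N(2) cong_iff_dvd_diff)
    then have "[P (2 * N) + P 0 = 2 * P 0] (mod int p)"
      using cong_add_rcancel [of "P (2 * N)" "P 0" "P 0"] by simp
    moreover have "\<not> int p dvd P 0"
      using assms(1) \<open>finite U\<close> unfolding P_def punctured_prod_def U_def
      by (auto simp: prime_dvd_prod_iff)
    moreover have "\<not> int p dvd 2"
      using odd_prime_not_dvd_2 [OF assms(1,2)] int_dvd_int_iff [of p 2] by simp
    ultimately have "\<not> int p dvd P (2 * N) + P 0"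
      using assms(1) by (auto simp: cong_dvd_iff prime_dvd_mult_iff)
    then show ?thesis
      using assms(1) unfolding q_def by (auto intro!: prime_imp_coprime)
  qed
  ultimately have "[P (2 * N) = P 0 * 1] (mod int p ^ (3 * k))"
    by (simp add: coprime_dvd_mult_left_iff cong_iff_dvd_diff q3)
  moreover have "m > 0"
    using assms by (simp add: m_def prime_gt_0_nat)
  ultimately have "[third_binomial (p * m) = third_binomial m * 1] (mod int p ^ (3 * k))"
    using assms(1) unfolding P_def N_def
    by (intro punctured_prod_cong_imp_third_binomial_cong)
  then show ?thesis
    unfolding pm by (simp add: m_def)
qed

section \<open>The prime two\<close>

text \<open>Modulo a power of two, a square does not determine its root up to sign. So the pairs are counted once here,
  over half of the range, in place of squaring the whole product. The reflection
  fixes \<open>m\<close>, which has to be counted when it is odd.\<close>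

lemma prod_odd_pairs:
  fixes m :: int and g :: "int \<Rightarrow> 'a :: comm_monoid_mult"
  assumes "m > 0"
  shows "(\<Prod>i | 0 < i \<and> i < 2 * m \<and> odd i. g i)
    = (\<Prod>i | 0 < i \<and> i < m \<and> odd i. g i * g (2 * m - i)) * (if odd m then g m else 1)"
proof -
  let ?H = "{i. 0 < i \<and> i < m \<and> odd i}"
  let ?M = "if odd m then {m} else {}"
  have fin: "finite ?H"
    by (rule finite_subset [of _ "{0<..<m}"]) auto
  have split: "{i. 0 < i \<and> i < 2 * m \<and> odd i} = ?H \<union> (\<lambda>i. 2 * m - i) ` ?H \<union> ?M" (is "?U = ?V")
  proof
    show "?U \<subseteq> ?V"
    proof
      fix i assume i: "i \<in> ?U"
      consider "i < m" | "i = m" | "m < i"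
        by linarith
      then show "i \<in> ?V"
      proof cases
        case 3
        then have "2 * m - i \<in> ?H" and "i = 2 * m - (2 * m - i)"
          using i by auto
        then show ?thesis
          by blast
      qed (use i in auto)
    qed
  qed (use assms in auto)
  have "prod g ?U = prod g (?H \<union> (\<lambda>i. 2 * m - i) ` ?H) * prod g ?M"
    unfolding split using fin by (intro prod.union_disjoint) auto
  also have "prod g (?H \<union> (\<lambda>i. 2 * m - i) ` ?H) = prod g ?H * prod g ((\<lambda>i. 2 * m - i) ` ?H)"
    using fin by (intro prod.union_disjoint) auto
  also have "prod g ((\<lambda>i. 2 * m - i) ` ?H) = (\<Prod>i\<in>?H. g (2 * m - i))"
    by (subst prod.reindex) (auto simp: inj_on_def)
  finally show ?thesis
    by (simp add: prod.distrib)
qed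

text \<open>Doubling the range from \<open>M\<close> to \<open>2M\<close> repeats the summands, because \<open>(i + M)\<^sup>2\<close> and
  \<open>i\<^sup>2\<close> agree modulo \<open>2M\<close> for even \<open>M\<close>. So the sum doubles with its modulus, and
  starts as a sum of \<open>c\<close> odd numbers.\<close>

lemma sum_odd_square_powers_cong:
  fixes c :: int
  assumes "odd c" "c > 0"
  shows "[(\<Sum>i | 0 < i \<and> i < 2 ^ Suc j * c \<and> odd i. (i ^ 2) ^ t) = 2 ^ j] (mod 2 ^ Suc j)"
proof (induction j)
  case 0
  have "{i. 0 < i \<and> i < 2 * c \<and> odd i} = (\<lambda>i. 2 * i + 1) ` {0..<c}"
    by (auto simp: image_iff elim!: oddE)
  moreover have "inj_on (\<lambda>i. 2 * i + 1) {0..<c}"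
    by (simp add: inj_on_def)
  ultimately have "card {i. 0 < i \<and> i < 2 * c \<and> odd i} = nat c"
    by (simp add: card_image)
  moreover have "{i \<in> {i. 0 < i \<and> i < 2 * c \<and> odd i}. odd ((i ^ 2) ^ t)} = {i. 0 < i \<and> i < 2 * c \<and> odd i}"
    by auto
  moreover have "finite {i. 0 < i \<and> i < 2 * c \<and> odd i}"
    by (rule finite_subset [of _ "{0<..<2 * c}"]) auto
  ultimately have "odd (\<Sum>i | 0 < i \<and> i < 2 * c \<and> odd i. (i ^ 2) ^ t)"
    using assms by (simp add: even_sum_iff even_nat_iff)
  then show ?case
    by (simp add: cong_iff_dvd_diff)
next
  case (Suc j)
  define M where "M = 2 ^ Suc j * c"
  let ?h = "\<lambda>i :: int. (i ^ 2) ^ t"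
  let ?A = "{i. 0 < i \<and> i < M \<and> odd i}"
  have fin: "finite ?A"
    by (rule finite_subset [of _ "{0<..<M}"]) auto
  have M: "M > 0" "even M"
    using assms by (auto simp: M_def)
  have "{i. 0 < i \<and> i < 2 * M \<and> odd i} = ?A \<union> (\<lambda>i. i + M) ` ?A" (is "?U = ?V")
  proof
    show "?U \<subseteq> ?V"
    proof
      fix i assume i: "i \<in> ?U"
      show "i \<in> ?V"
      proof (cases "i < M")
        case False
        have "i \<noteq> M"
          using i M by auto
        then have "i - M \<in> ?A" "i = (i - M) + M"
          using i M False by auto
        then show ?thesis
          by blast
      qed (use i in auto)
    qed
    show "?V \<subseteq> ?U"
      using M by auto
  qed
  moreover have "?A \<inter> (\<lambda>i. i + M) ` ?A = {}"
    by auto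
  ultimately have "sum ?h ?U = sum ?h ?A + (\<Sum>i\<in>?A. ?h (i + M))"
    using fin by (simp only: sum.union_disjoint finite_imageI) (simp add: sum.reindex)
  moreover have "[(\<Sum>i\<in>?A. ?h (i + M)) = sum ?h ?A] (mod 2 ^ Suc (Suc j))"
  proof (rule cong_sum)
    fix i :: int
    have "(2 ^ Suc j :: int) * 2 dvd M * (2 * i + M)"
      using M by (intro mult_dvd_mono) (auto simp: M_def)
    also have "M * (2 * i + M) = (i + M) ^ 2 - i ^ 2"
      by (simp add: power2_eq_square algebra_simps)
    finally have "[(i + M) ^ 2 = i ^ 2] (mod 2 ^ Suc (Suc j))"
      by (simp add: cong_iff_dvd_diff mult.commute)
    then show "[?h (i + M) = ?h i] (mod 2 ^ Suc (Suc j))"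
      by (rule cong_pow)
  qed
  ultimately have "[sum ?h ?U = 2 * sum ?h ?A] (mod 2 ^ Suc (Suc j))"
    by (simp only: mult_2 cong_add_lcancel)
  moreover have "[2 * sum ?h ?A = 2 ^ Suc j] (mod 2 ^ Suc (Suc j))"
    using cong_cmult_leftI [OF Suc.IH, of 2] unfolding M_def by (simp only: power_Suc)
  ultimately have "[sum ?h ?U = 2 ^ Suc j] (mod 2 ^ Suc (Suc j))"
    by (rule cong_trans)
  then show ?case
    unfolding M_def by (simp only: power_Suc mult.assoc)
qed

text \<open>The correction \<open>2 ^ (3k - 1)\<close> has two sources. For \<open>k = 1\<close> the linear term over the pairs vanishes
  modulo \<open>8\<close>, and the fixed point \<open>i = m\<close> contributes \<open>(4m + m) / m = 5 = 1 + 2\<^sup>2\<close>.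
  For \<open>k > 1\<close> there is no fixed point, and the linear term is \<open>6N\<^sup>2\<close> times a sum over
  the odd \<open>i\<close> below \<open>2 ^ (k - 1) d\<close> that is exactly divisible by \<open>2 ^ (k - 2)\<close>.\<close>

lemma third_binomial_cong_2:
  fixes k d :: nat
  assumes "k > 0" "odd d"
  shows "[third_binomial (2 ^ k * d)
    = third_binomial (2 ^ (k - 1) * d) * (1 + 2 ^ (3 * k - 1))] (mod 2 ^ (3 * k))"
proof -
  define m where "m = 2 ^ (k - 1) * d"
  define N where "N = int (2 * m)"
  define q where "q = (2 :: int) ^ k"
  define H where "H = {i. 0 < i \<and> i < int m \<and> odd i}"
  define P where "P = punctured_prod 2 N"
  define e where "e x = (if odd m then x + int m else 1)" for x
  have m: "m > 0"
    using assms by (auto simp: m_def intro: gr0I)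
  have pm: "2 * m = 2 ^ k * d"
    using assms(1) by (simp add: m_def power_eq_if)
  have q3: "q ^ 3 = 2 ^ (3 * k)"
    by (simp add: q_def power_mult [symmetric] mult.commute)
  have N: "N = q * int d"
    unfolding N_def pm by (simp add: q_def)
  obtain t where t: "\<And>y. coprime y ((2 :: int) ^ k) \<Longrightarrow> [y ^ Suc t = 1] (mod 2 ^ k)"
    using ex_inverse_exponent [of "2 ^ k"] by auto
  have "finite H"
    unfolding H_def by (rule finite_subset [of _ "{0<..<int m}"]) auto
  have fold: "P x = (\<Prod>i\<in>H. x * (x + N) + i * (N - i)) * e x" for x
    using prod_odd_pairs [of "int m" "\<lambda>i. x + i"] m
    unfolding P_def punctured_prod_def N_def H_def e_def
    by (simp add: algebra_simps)
  let ?S = "\<Sum>i\<in>H. (i ^ 2) ^ t"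
  have x: "2 * N * (2 * N + N) = N * N * 6"
    by simp
  have NN: "q ^ 2 dvd N * N"
    unfolding N power2_eq_square by (intro mult_dvd_mono) auto
  have "[(\<Prod>i\<in>H. N * N * 6 + i * (N - i)) = (\<Prod>i\<in>H. i * (N - i)) * (1 - N * N * 6 * ?S)] (mod q ^ 3)"
  proof (rule prod_shifted_pairs_cong)
    show "[(i ^ 2) ^ Suc t = 1] (mod q)" if "i \<in> H" for i
      using that unfolding q_def H_def by (intro t) simp
  qed (use NN N \<open>finite H\<close> in auto)
  then have "[P (2 * N) = (\<Prod>i\<in>H. i * (N - i)) * (1 - N * N * 6 * ?S) * e (2 * N)] (mod q ^ 3)"
    unfolding fold x by (rule cong_scalar_right)
  also have "(\<Prod>i\<in>H. i * (N - i)) * (1 - N * N * 6 * ?S) * e (2 * N)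
      = (\<Prod>i\<in>H. i * (N - i)) * ((1 - N * N * 6 * ?S) * e (2 * N))"
    by (simp only: mult.assoc)
  also have "[\<dots> = (\<Prod>i\<in>H. i * (N - i)) * (e 0 * (1 + 2 ^ (3 * k - 1)))] (mod q ^ 3)"
  proof (rule cong_scalar_left)
    show "[(1 - N * N * 6 * ?S) * e (2 * N) = e 0 * (1 + 2 ^ (3 * k - 1))] (mod q ^ 3)"
    proof (cases "k = 1")
      case True
      then have "e (2 * N) = e 0 * (1 + 2 ^ (3 * k - 1))"
        using assms(2) by (simp add: e_def N_def m_def)
      moreover have "q ^ 3 dvd N * N * 6 * ?S"
        using True by (simp add: N q_def)
      then have "[1 - N * N * 6 * ?S = 1] (mod q ^ 3)"
        by (simp add: cong_iff_dvd_diff)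
      then have "[(1 - N * N * 6 * ?S) * e (2 * N) = 1 * e (2 * N)] (mod q ^ 3)"
        by (rule cong_scalar_right)
      ultimately show ?thesis
        by simp
    next
      case False
      then obtain j where k: "k = Suc (Suc j)"
        using assms(1) by (metis One_nat_def not0_implies_Suc not_gr0)
      have "int m = 2 ^ Suc j * int d"
        by (simp add: m_def k)
      then have "[?S = 2 ^ j] (mod 2 ^ Suc j)"
        using sum_odd_square_powers_cong [of "int d" t j] assms(2) unfolding H_def
        by (simp add: odd_pos)
      then obtain u where u: "?S = 2 ^ j + 2 ^ Suc j * u"
        unfolding cong_iff_lin by (metis mult.commute cong_iff_lin cong_sym)
      \<comment> \<open>The linear term is an odd multiple of \<open>2 ^ (3 * k - 1)\<close>, where \<open>3 * k - 1 = 2 * k + j + 1\<close>.\<close>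
      have "even (3 * (int d * int d) * (1 + 2 * u) + 1)"
        using assms(2) by simp
      then obtain v where v: "3 * (int d * int d) * (1 + 2 * u) + 1 = 2 * v"
        by (elim evenE)
      have "1 - N * N * 6 * ?S - (1 + 2 ^ (3 * k - 1))
          = - (2 * 2 ^ (2 * k + j)) * (3 * (int d * int d) * (1 + 2 * u) + 1)"
        unfolding u N q_def k by (simp add: algebra_simps power_add power_mult power2_eq_square power3_eq_cube)
      also have "\<dots> = q ^ 3 * (- v)"
        unfolding v q3 k by (simp add: power_add power_mult algebra_simps)
      finally have "[1 - N * N * 6 * ?S = 1 + 2 ^ (3 * k - 1)] (mod q ^ 3)"
        by (simp add: cong_iff_dvd_diff)
      moreover have "e x = 1" for x
        by (simp add: e_def m_def k)
      ultimately show ?thesis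
        by simp
    qed
  qed
  also have "(\<Prod>i\<in>H. i * (N - i)) * (e 0 * (1 + 2 ^ (3 * k - 1))) = P 0 * (1 + 2 ^ (3 * k - 1))"
    unfolding fold by simp
  finally have "[P (2 * N) = P 0 * (1 + 2 ^ (3 * k - 1))] (mod int 2 ^ (3 * k))"
    by (simp add: q3)
  then have "[third_binomial (2 * m) = third_binomial m * (1 + 2 ^ (3 * k - 1))] (mod int 2 ^ (3 * k))"
    using m unfolding P_def N_def
    by (intro punctured_prod_cong_imp_third_binomial_cong) simp_all
  then show ?thesis
    unfolding pm by (simp add: m_def)
qed

section \<open>Moebius sums at one prime\<close>

lemma moebius_mu_prime_mult:
  assumes "prime p" "\<not> p dvd n" "n > 0"
  shows "moebius_mu (p * n) = - moebius_mu n"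
proof -
  have "coprime p n"
    using assms by (simp add: prime_imp_coprime)
  then have "squarefree (p * n) \<longleftrightarrow> squarefree n"
    using assms(1) by (auto intro: squarefree_mult_coprime squarefree_prime squarefree_mono dvd_triv_right)
  moreover have "prime_factors (p * n) = insert p (prime_factors n)"
    using assms by (subst prime_factors_product) (auto simp: prime_factorization_prime)
  moreover have "p \<notin> prime_factors n"
    using assms by (simp add: in_prime_factors_iff)
  ultimately show ?thesis
    by (simp add: moebius_mu_def)
qed

lemma moebius_mu_eq_0:
  assumes "prime p" "p ^ 2 dvd n"
  shows "moebius_mu n = 0"
  using assms squarefreeD [of n p] by (auto simp: moebius_mu_def)

text \<open>A divisor \<open>d\<close> contributes only if its cofactor is squarefree, so \<open>d\<close> contains \<open>p\<close> to the power \<open>k\<close> or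
  \<open>k - 1\<close>. The two choices have opposite signs, which gathers the sum into the differences
  that the congruences at \<open>p\<close> control.\<close>

lemma moebius_sum_prime_power:
  fixes f :: "nat \<Rightarrow> int"
  assumes "prime p" "\<not> p dvd s" "k > 0" "s > 0"
  shows "(\<Sum>d | d dvd p ^ k * s. moebius_mu (p ^ k * s div d) * f d)
    = (\<Sum>d | d dvd s. moebius_mu (s div d) * (f (p ^ k * d) - f (p ^ (k - 1) * d)))"
proof -
  let ?r = "p ^ k * s" and ?D = "{d. d dvd s}"
  let ?g = "\<lambda>d. moebius_mu (?r div d) * f d"
  have p: "p > 0"
    using assms(1) by (simp add: prime_gt_0_nat)
  have pk: "p ^ k = p ^ (k - 1) * p"
    using assms(3) by (simp add: power_eq_if)
  have fin: "finite ?D"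
    using assms(4) by simp
  have cofactor: "\<not> p dvd s div d" "s div d > 0" if "d dvd s" for d
    using that assms(2,4) by (metis dvd_div_mult_self dvd_mult2, auto elim!: dvdE)
  have disj: "((*) (p ^ k)) ` ?D \<inter> ((*) (p ^ (k - 1))) ` ?D = {}"
  proof -
    have "p ^ k * d \<noteq> p ^ (k - 1) * e" if "e dvd s" for d e
    proof
      assume "p ^ k * d = p ^ (k - 1) * e"
      then have "p * d = e"
        using p unfolding pk by simp
      then show False
        using that assms(2) dvd_mult_left by blast
    qed
    then show ?thesis
      by auto
  qed
  have "(\<Sum>d | d dvd ?r. ?g d) = sum ?g (((*) (p ^ k)) ` ?D \<union> ((*) (p ^ (k - 1))) ` ?D)"
  proof (rule sum.mono_neutral_right)
    show "finite {d. d dvd ?r}"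
      using p assms(4) by simp
    show "((*) (p ^ k)) ` ?D \<union> ((*) (p ^ (k - 1))) ` ?D \<subseteq> {d. d dvd ?r}"
      by (auto intro!: mult_dvd_mono le_imp_power_dvd)
    show "\<forall>d\<in>{d. d dvd ?r} - (((*) (p ^ k)) ` ?D \<union> ((*) (p ^ (k - 1))) ` ?D). ?g d = 0"
    proof
      fix d assume d: "d \<in> {d. d dvd ?r} - (((*) (p ^ k)) ` ?D \<union> ((*) (p ^ (k - 1))) ` ?D)"
      then obtain b e where be: "d = b * e" "b dvd p ^ k" "e dvd s"
        using division_decomp by blast
      then obtain j where j: "b = p ^ j" "j \<le> k"
        using assms(1) divides_primepow_nat by blast
      have "j \<noteq> k" "j \<noteq> k - 1"
        using d be j by auto
      then have "k = j + 2 + (k - j - 2)"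
        using j by simp
      then have "p ^ k = p ^ j * (p ^ 2 * p ^ (k - j - 2))"
        by (metis power_add mult.assoc)
      moreover obtain c where "s = e * c"
        using be by (elim dvdE)
      ultimately have "?r = d * (p ^ 2 * (p ^ (k - j - 2) * c))"
        by (simp add: be j)
      moreover have "d > 0"
        using be assms(4) p j by (auto intro: gr0I)
      ultimately have "p ^ 2 dvd ?r div d"
        by (metis dvd_triv_left nonzero_mult_div_cancel_left less_not_refl)
      then show "?g d = 0"
        using assms(1) by (simp add: moebius_mu_eq_0)
    qed
  qed
  also have "\<dots> = sum ?g (((*) (p ^ k)) ` ?D) + sum ?g (((*) (p ^ (k - 1))) ` ?D)"
    using fin disj by (intro sum.union_disjoint) auto
  also have "sum ?g (((*) (p ^ k)) ` ?D) = (\<Sum>d\<in>?D. moebius_mu (s div d) * f (p ^ k * d))"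
    using p by (subst sum.reindex) (auto simp: inj_on_def)
  also have "sum ?g (((*) (p ^ (k - 1))) ` ?D) = (\<Sum>d\<in>?D. - moebius_mu (s div d) * f (p ^ (k - 1) * d))"
  proof (subst sum.reindex)
    show "inj_on ((*) (p ^ (k - 1))) ?D"
      using p by (auto simp: inj_on_def)
    have "?r div (p ^ (k - 1) * d) = p * (s div d)" if "d dvd s" for d
      using that p unfolding pk by (simp add: mult.assoc div_mult_swap)
    then show "sum (?g \<circ> (*) (p ^ (k - 1))) ?D = (\<Sum>d\<in>?D. - moebius_mu (s div d) * f (p ^ (k - 1) * d))"
      using assms(1) cofactor by (intro sum.cong) (simp_all add: moebius_mu_prime_mult)
  qed
  finally show ?thesis
    by (simp add: sum.distrib [symmetric] algebra_simps)
qed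

section \<open>The parity of the binomials\<close>

text \<open>This lemma and the next one are Lucas' theorem modulo two, one binary digit at a time.\<close>

lemma even_binomial_double:
  "even ((2 * n) choose (2 * k + 1))"
  "even ((2 * n) choose (2 * k)) \<longleftrightarrow> even (n choose k)"
proof -
  show A: "even ((2 * n) choose (2 * k + 1))" for n k
  proof (cases n)
    case (Suc m)
    have "(2 * k + 1) * ((2 * n) choose (2 * k + 1)) = 2 * n * ((2 * n - 1) choose (2 * k))"
      using Suc_times_binomial_eq [of "2 * n - 1" "2 * k"] Suc by (simp add: mult.commute)
    then have "even ((2 * k + 1) * ((2 * n) choose (2 * k + 1)))"
      by simp
    then show ?thesis
      by simp
  qed simp
  show "even ((2 * n) choose (2 * k)) \<longleftrightarrow> even (n choose k)"
  proof (induction n arbitrary: k)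
    case 0
    then show ?case
      by (cases k) simp_all
  next
    case (Suc n)
    show ?case
    proof (cases k)
      case (Suc l)
      have "(2 * Suc n) choose (2 * k)
          = ((2 * n) choose (2 * l)) + 2 * ((2 * n) choose (2 * l + 1)) + ((2 * n) choose (2 * Suc l))"
        by (simp add: Suc)
      then show ?thesis
        using A [of n l] Suc.IH [of l] Suc.IH [of "Suc l"] by (simp add: Suc)
    qed simp
  qed
qed

lemma even_binomial_double_Suc:
  "even ((2 * n + 1) choose (2 * k)) \<longleftrightarrow> even (n choose k)"
  "even ((2 * n + 1) choose (2 * k + 1)) \<longleftrightarrow> even (n choose k)"
proof -
  show "even ((2 * n + 1) choose (2 * k)) \<longleftrightarrow> even (n choose k)"
  proof (cases k)
    case (Suc l)
    have "(2 * n + 1) choose (2 * k) = ((2 * n) choose (2 * l + 1)) + ((2 * n) choose (2 * k))"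
      by (simp add: Suc)
    then show ?thesis
      using even_binomial_double [of n] by simp
  qed simp
  have "(2 * n + 1) choose (2 * k + 1) = ((2 * n) choose (2 * k)) + ((2 * n) choose (2 * k + 1))"
    by simp
  then show "even ((2 * n + 1) choose (2 * k + 1)) \<longleftrightarrow> even (n choose k)"
    using even_binomial_double [of n k] by simp
qed

text \<open>Adding \<open>n\<close> and \<open>2n\<close> in binary produces no carry precisely if \<open>n\<close> has no two adjacent ones. The recursion
  is on \<open>n\<close>: a final \<open>0\<close> and a final \<open>01\<close> can be dropped on both sides, and a final \<open>11\<close> makes
  the binomial even.\<close>

lemma odd_binomial_3n_n_iff:
  "odd ((3 * n) choose n) \<longleftrightarrow> (\<forall>j. \<not> (bit n j \<and> bit n (Suc j)))"
proof (induction n rule: less_induct)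
  case (less n)
  have all_Suc: "(\<forall>j. Q j) \<longleftrightarrow> Q 0 \<and> (\<forall>j. Q (Suc j))" for Q :: "nat \<Rightarrow> bool"
    by (metis not0_implies_Suc)
  consider "n = 0" | k where "n = 2 * k" "k > 0" | k where "n = 2 * (2 * k) + 1" | k where "n = 2 * (2 * k + 1) + 1"
    by (metis evenE gr0I mult_0_right oddE)
  then show ?case
  proof cases
    case 1
    then show ?thesis
      by simp
  next
    case 2
    have "odd ((3 * n) choose n) \<longleftrightarrow> odd ((3 * k) choose k)"
      using even_binomial_double(2) [of "3 * k" k] by (simp add: 2 mult.left_commute)
    also have "\<dots> \<longleftrightarrow> (\<forall>j. \<not> (bit k j \<and> bit k (Suc j)))"
      using 2 by (intro less) simp
    also have "\<dots> \<longleftrightarrow> (\<forall>j. \<not> (bit n j \<and> bit n (Suc j)))"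
      by (subst (2) all_Suc) (simp add: 2 bit_0 bit_Suc)
    finally show ?thesis .
  next
    case 3
    have "3 * n = 2 * (2 * (3 * k) + 1) + 1"
      by (simp add: 3)
    then have "odd ((3 * n) choose n) \<longleftrightarrow> odd ((2 * (3 * k) + 1) choose (2 * k))"
      using even_binomial_double_Suc(2) 3 by metis
    also have "\<dots> \<longleftrightarrow> odd ((3 * k) choose k)"
      using even_binomial_double_Suc(1) by blast
    also have "\<dots> \<longleftrightarrow> (\<forall>j. \<not> (bit k j \<and> bit k (Suc j)))"
      using 3 by (intro less) simp
    also have "\<dots> \<longleftrightarrow> (\<forall>j. \<not> (bit n j \<and> bit n (Suc j)))"
      by (subst (2) all_Suc, subst (2) all_Suc) (simp add: 3 bit_0 bit_Suc)
    finally show ?thesis .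
  next
    case 4
    have "3 * n = 2 * (2 * (3 * k + 2)) + 1"
      by (simp add: 4)
    then have "even ((3 * n) choose n) \<longleftrightarrow> even ((2 * (3 * k + 2)) choose (2 * k + 1))"
      using even_binomial_double_Suc(2) 4 by metis
    then have "even ((3 * n) choose n)"
      using even_binomial_double(1) by blast
    moreover have "bit n 0 \<and> bit n (Suc 0)"
      by (simp add: 4 bit_0 bit_Suc)
    ultimately show ?thesis
      by blast
  qed
qed

section \<open>Integrality\<close>

definition moebius_sum :: "nat \<Rightarrow> int" where
  "moebius_sum r = (\<Sum>d | d dvd r. moebius_mu (r div d) * third_binomial d)"

lemma n_r_div_eq: "n_r r / of_nat r = of_int (moebius_sum r) / of_int (int r ^ 3)"
  by (simp add: n_r_def moebius_sum_def third_binomial_def power3_eq_cube power2_eq_square)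

lemma odd_prime_power_dvd_moebius_sum:
  assumes "prime p" "odd p" "\<not> p dvd s" "s > 0" "k > 0"
  shows "int p ^ (3 * k) dvd moebius_sum (p ^ k * s)"
proof -
  have "int p ^ (3 * k) dvd third_binomial (p ^ k * d) - third_binomial (p ^ (k - 1) * d)"
    if "d dvd s" for d
    using third_binomial_cong_odd_prime [of p k d] assms that
    by (simp add: cong_iff_dvd_diff dvd_pos_nat)
  then have "int p ^ (3 * k) dvd
      (\<Sum>d | d dvd s. moebius_mu (s div d) * (third_binomial (p ^ k * d) - third_binomial (p ^ (k - 1) * d)))"
    by (intro dvd_sum dvd_mult) simp
  then show ?thesis
    unfolding moebius_sum_def moebius_sum_prime_power [OF assms(1,3,5,4)] .
qed

text \<open>The cube of the odd part is assembled prime by prime; for each \<open>p\<close> the role of \<open>s\<close> in the local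
  statement is played by the whole cofactor of the power of \<open>p\<close>, with its power of two.\<close>

lemma odd_part_cube_dvd_moebius_sum:
  assumes "odd s"
  shows "int s ^ 3 dvd moebius_sum (2 ^ k * s)"
proof (cases "moebius_sum (2 ^ k * s) = 0")
  case False
  let ?S = "nat \<bar>moebius_sum (2 ^ k * s)\<bar>"
  have s: "s > 0"
    using assms by (rule odd_pos)
  have "s ^ 3 dvd ?S"
  proof (rule multiplicity_le_imp_dvd)
    fix p :: nat assume p: "prime p"
    define a where "a = multiplicity p s"
    show "multiplicity p (s ^ 3) \<le> multiplicity p ?S"
    proof (cases "a = 0")
      case True
      then show ?thesis
        using p s by (simp add: a_def prime_elem_multiplicity_power_distrib)
    next
      case a: False
      obtain s' where s': "s = p ^ a * s'" "\<not> p dvd s'"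
        using multiplicity_decompose' [of s p] s p not_prime_unit [of p] unfolding a_def by (metis less_not_refl)
      have "p dvd s"
        using a unfolding a_def by (metis not_dvd_imp_multiplicity_0)
      then have "odd p"
        using assms by (auto dest: dvd_trans)
      moreover have "\<not> p dvd 2 ^ k * s'"
        using p s'(2) odd_prime_not_dvd_2 [OF p \<open>odd p\<close>]
        by (auto simp: prime_dvd_mult_iff dest: prime_dvd_power)
      moreover have "2 ^ k * s' > 0"
        using s s' by (auto intro: gr0I)
      ultimately have "int p ^ (3 * a) dvd moebius_sum (p ^ a * (2 ^ k * s'))"
        using p a by (intro odd_prime_power_dvd_moebius_sum) simp_all
      also have "p ^ a * (2 ^ k * s') = 2 ^ k * s"
        by (simp add: s'(1) mult_ac)
      finally have "p ^ (3 * a) dvd ?S"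
        by (simp add: nat_dvd_iff flip: of_nat_power)
      then have "3 * a \<le> multiplicity p ?S"
        using p False by (intro multiplicity_geI) auto
      then show ?thesis
        using p s by (simp add: a_def prime_elem_multiplicity_power_distrib)
    qed
  qed (use s in simp)
  then show ?thesis
    by (simp add: nat_dvd_iff flip: of_nat_power)
qed simp

lemma odd_third_binomial_iff:
  assumes "odd d"
  shows "odd (third_binomial (2 ^ j * d)) \<longleftrightarrow> well_spaced d"
proof -
  have d: "d > 0"
    using assms by (rule odd_pos)
  have "odd (third_binomial (2 ^ j * d)) \<longleftrightarrow> odd ((3 * (2 ^ j * d)) choose (2 ^ j * d))"
    using binomial_3n_n_eq [of "2 ^ j * d"] d
    by (metis even_mult_iff even_of_nat_iff odd_numeral nat_0_less_mult_iff zero_less_numeral zero_less_power)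
  also have "\<dots> \<longleftrightarrow> odd ((3 * d) choose d)"
  proof (induction j)
    case (Suc j)
    then show ?case
      using even_binomial_double(2) [of "3 * (2 ^ j * d)" "2 ^ j * d"] by (simp add: mult_ac)
  qed simp
  also have "\<dots> \<longleftrightarrow> well_spaced d"
    using d by (simp add: odd_binomial_3n_n_iff well_spaced_def)
  finally show ?thesis .
qed

text \<open>Modulo \<open>2 ^ (3k)\<close> each difference in the Moebius sum is \<open>2 ^ (3k - 1)\<close> times a binomial. So only
  the parities of the summands matter, and a summand is odd exactly for a well-spaced divisor
  with squarefree cofactor.\<close>

lemma moebius_sum_mod_power_of_2:
  fixes s k :: nat
  assumes "odd s" "k > 0"
  defines "W \<equiv> {w \<in> odd_well_spaced. w dvd s \<and> squarefree (s div w)}"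
  obtains T where "[moebius_sum (2 ^ k * s) = 2 ^ (3 * k - 1) * T] (mod 2 ^ (3 * k))"
    and "even T \<longleftrightarrow> even (card W)"
proof -
  let ?a = "\<lambda>d. third_binomial (2 ^ (k - 1) * d)"
  define T where "T = (\<Sum>d | d dvd s. moebius_mu (s div d) * ?a d)"
  have s: "s > 0"
    using assms(1) by (rule odd_pos)
  have odd: "odd d" if "d dvd s" for d
    using that assms(1) dvd_trans by blast
  have "[(\<Sum>d | d dvd s. moebius_mu (s div d) * (third_binomial (2 ^ k * d) - ?a d))
      = (\<Sum>d | d dvd s. moebius_mu (s div d) * (2 ^ (3 * k - 1) * ?a d))] (mod 2 ^ (3 * k))"
  proof (intro cong_sum cong_scalar_left)
    fix d assume "d \<in> {d. d dvd s}"
    then have "[third_binomial (2 ^ k * d) - ?a d = ?a d * (1 + 2 ^ (3 * k - 1)) - ?a d] (mod 2 ^ (3 * k))"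
      using assms(2) odd by (intro cong_diff third_binomial_cong_2 cong_refl) auto
    then show "[third_binomial (2 ^ k * d) - ?a d = 2 ^ (3 * k - 1) * ?a d] (mod 2 ^ (3 * k))"
      by (simp add: algebra_simps)
  qed
  moreover have "moebius_sum (2 ^ k * s)
      = (\<Sum>d | d dvd s. moebius_mu (s div d) * (third_binomial (2 ^ k * d) - ?a d))"
    unfolding moebius_sum_def using assms s by (intro moebius_sum_prime_power) auto
  moreover have "(\<Sum>d | d dvd s. moebius_mu (s div d) * (2 ^ (3 * k - 1) * ?a d)) = 2 ^ (3 * k - 1) * T"
    unfolding T_def sum_distrib_left by (intro sum.cong) simp_all
  ultimately have T: "[moebius_sum (2 ^ k * s) = 2 ^ (3 * k - 1) * T] (mod 2 ^ (3 * k))"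
    by (simp only:)
  have "even (moebius_mu n) \<longleftrightarrow> \<not> squarefree n" for n
    by (simp add: moebius_mu_def)
  moreover have "even (?a d) \<longleftrightarrow> \<not> well_spaced d" if "d dvd s" for d
    using odd_third_binomial_iff [OF odd [OF that]] by blast
  ultimately have "{d \<in> {d. d dvd s}. odd (moebius_mu (s div d) * ?a d)} = W"
    using odd by (auto simp: W_def odd_well_spaced_def)
  then have "even T \<longleftrightarrow> even (card W)"
    unfolding T_def using s by (subst even_sum_iff) simp_all
  with T show thesis
    by (rule that)
qed

theorem theorem1:
  fixes r :: nat
  assumes "r > 0"
  shows "2 * n_r r / of_nat r \<in> \<int> \<and>
    (n_r r / of_nat r \<in> \<int> \<longleftrightarrow>
      odd r \<or>
      (\<exists>k r1. k > 0 \<and> odd r1 \<and> r = 2 ^ k * r1 \<and>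
        even (card {w \<in> odd_well_spaced. w dvd r1 \<and> squarefree (r1 div w)})))"
proof -
  let ?W = "\<lambda>s. {w \<in> odd_well_spaced. w dvd s \<and> squarefree (s div w)}"
  obtain k s where r: "r = 2 ^ k * s" "odd s"
    using multiplicity_decompose' [of r 2] assms by (metis less_not_refl odd_one)
  have s3: "int s ^ 3 dvd moebius_sum r"
    unfolding r using r(2) by (rule odd_part_cube_dvd_moebius_sum)
  have r3: "int r ^ 3 = 2 ^ (3 * k) * int s ^ 3"
    by (simp add: r power_mult_distrib power_mult [symmetric] mult.commute)
  have dvd_iff: "2 ^ (3 * k) * int s ^ 3 dvd c * moebius_sum r \<longleftrightarrow> 2 ^ (3 * k) dvd c * moebius_sum r" for c
  proof -
    have "coprime (2 ^ (3 * k)) (int s ^ 3)"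
      using r(2) by simp
    then show ?thesis
      using s3 by (auto intro: divides_mult dvd_mult_left)
  qed
  have Ints_iff: "of_int c * (n_r r / of_nat r) \<in> \<int> \<longleftrightarrow> 2 ^ (3 * k) dvd c * moebius_sum r" for c
  proof -
    have "of_int c * (n_r r / of_nat r) = of_int (c * moebius_sum r) / of_int (int r ^ 3)"
      unfolding n_r_div_eq by simp
    also have "\<dots> \<in> \<int> \<longleftrightarrow> int r ^ 3 dvd c * moebius_sum r"
      using assms by (subst of_int_div_of_int_in_Ints_iff) simp
    finally show ?thesis
      unfolding r3 dvd_iff .
  qed
  show ?thesis
  proof (cases "k = 0")
    case True
    then show ?thesis
      using Ints_iff [of 1] Ints_iff [of 2] r by simp
  next
    case False
    then obtain T where T: "[moebius_sum r = 2 ^ (3 * k - 1) * T] (mod 2 ^ (3 * k))"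
        and parity: "even T \<longleftrightarrow> even (card (?W s))"
      using moebius_sum_mod_power_of_2 [of s k] r by auto
    have pow: "(2 :: int) ^ (3 * k) = 2 ^ (3 * k - 1) * 2"
      using False by (simp add: power_eq_if)
    have "2 ^ (3 * k) dvd 2 * moebius_sum r"
      using cong_dvd_iff [OF cong_scalar_left [OF T, of 2]] unfolding pow by (simp add: mult.left_commute)
    then have "2 * n_r r / of_nat r \<in> \<int>"
      using Ints_iff [of 2] by simp
    moreover have "n_r r / of_nat r \<in> \<int> \<longleftrightarrow> even (card (?W s))"
    proof -
      have "2 ^ (3 * k) dvd moebius_sum r \<longleftrightarrow> 2 ^ (3 * k) dvd 2 ^ (3 * k - 1) * T"
        using T by (rule cong_dvd_iff)
      also have "\<dots> \<longleftrightarrow> even T"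
        by (simp add: pow)
      finally show ?thesis
        using Ints_iff [of 1] parity by simp
    qed
    moreover have "even r"
      using r False by simp
    \<comment> \<open>The decomposition of \<open>r\<close> is unique, so the quantified statement is about this \<open>s\<close>.\<close>
    moreover have "s' = s" if "r = 2 ^ j * s'" "odd s'" for j s'
    proof -
      have mult: "multiplicity 2 r = i" if "r = 2 ^ i * u" "odd u" for i u
        using that by (intro multiplicity_eqI) simp_all
      have "j = k"
        using mult [OF that] mult [OF r] by simp
      then show ?thesis
        using that(1) r(1) by simp
    qed
    ultimately show ?thesis
      using False r by blast
  qed
qed

end
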